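(* For all valuations $\sigma \colon X \to M$ into a continuous model $M$ of $E$, and for all expressions $e$, we have $\hat\sigma(e) = \bar\sigma([\![e]\!]_E)$, where $\hat\sigma$ is the interpretation of expressions under $\sigma$ and $\bar\sigma(L)=\bigvee_{a\in L}\hat\sigma(a)$ is the extension of $\sigma$ to languages. In other words, interpretation under $\sigma$ factors through the standard language interpretation.
   Context: Fix a signature $\Sigma$, a set $X$ of variables, and a set $E$ of linear and regular term equations. Expressions are built from variables, symbols of $\Sigma$, $0$, $+$, and least fixpoints $\mu x.e$; they are interpreted in a complete algebra (an algebra ordered by a complete lattice with monotone operations) with $0$ as bottom, $+$ as binary join, and $\mu$ as least fixpoint. Atoms are terms over $\Sigma$ and $X$ quotiented by the equational theory of $E$; languages are sets of atoms, forming a continuous model of $E$ (powerset lifting). $[\![e]\!]_E$ denotes the standard language interpretation: the interpretation of $e$ in the language model under $x\mapsto\{x\}$. A continuous model of $E$ is a complete algebra which is a model of $E$ and whose operations preserve arbitrary joins in each argument. For an atom $a$, $\hat\sigma(a)$ is the value under the unique homomorphism extending $\sigma$ from atoms to $M$. *)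

theory Defs
  imports "HOL-Algebra.Complete_Lattice"
begin

section \<open>Terms and equations\<close>

text \<open>
  A signature is a type \<open>'f\<close> of symbols together with an arity function \<open>ar\<close>; the variables
  are the elements of a type \<open>'x\<close>. The datatypes below do not enforce arities, which is the
  role of the predicates \<open>wf_trm\<close> and \<open>wf_expr\<close>.
\<close>

datatype ('f, 'x) trm = Var 'x | Fun 'f "('f, 'x) trm list"

fun wf_trm :: "('f \<Rightarrow> nat) \<Rightarrow> ('f, 'x) trm \<Rightarrow> bool" where
  "wf_trm ar (Var x) \<longleftrightarrow> True"
| "wf_trm ar (Fun f ts) \<longleftrightarrow> length ts = ar f \<and> (\<forall>t \<in> set ts. wf_trm ar t)"

fun subst :: "('v \<Rightarrow> ('f, 'x) trm) \<Rightarrow> ('f, 'v) trm \<Rightarrow> ('f, 'x) trm" where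
  "subst \<theta> (Var v) = \<theta> v"
| "subst \<theta> (Fun f ts) = Fun f (map (subst \<theta>) ts)"

text \<open>The variable occurrences of a term, from left to right and with repetitions.\<close>

fun var_list :: "('f, 'x) trm \<Rightarrow> 'x list" where
  "var_list (Var x) = [x]"
| "var_list (Fun f ts) = concat (map var_list ts)"

text \<open>
  An equation is a pair of terms. The variables of the equations may be of another type than
  those of the expressions.
\<close>

type_synonym ('f, 'v) eqns = "(('f, 'v) trm \<times> ('f, 'v) trm) set"

definition wf_eqns :: "('f \<Rightarrow> nat) \<Rightarrow> ('f, 'v) eqns \<Rightarrow> bool" where
  "wf_eqns ar E \<longleftrightarrow> (\<forall>(l, r) \<in> E. wf_trm ar l \<and> wf_trm ar r)"

definition linear_eqns :: "('f, 'v) eqns \<Rightarrow> bool" where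
  "linear_eqns E \<longleftrightarrow> (\<forall>(l, r) \<in> E. distinct (var_list l) \<and> distinct (var_list r))"

definition regular_eqns :: "('f, 'v) eqns \<Rightarrow> bool" where
  "regular_eqns E \<longleftrightarrow> (\<forall>(l, r) \<in> E. set (var_list l) = set (var_list r))"

inductive eq_thy ::
  "('f \<Rightarrow> nat) \<Rightarrow> ('f, 'v) eqns \<Rightarrow> ('f, 'x) trm \<Rightarrow> ('f, 'x) trm \<Rightarrow> bool" for ar E where
  ax: "(l, r) \<in> E \<Longrightarrow> (\<And>v. wf_trm ar (\<theta> v)) \<Longrightarrow> eq_thy ar E (subst \<theta> l) (subst \<theta> r)"
| refl: "wf_trm ar t \<Longrightarrow> eq_thy ar E t t"
| sym: "eq_thy ar E s t \<Longrightarrow> eq_thy ar E t s"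
| trans: "eq_thy ar E s t \<Longrightarrow> eq_thy ar E t u \<Longrightarrow> eq_thy ar E s u"
| cong: "length ss = ar f \<Longrightarrow> list_all2 (eq_thy ar E) ss ts
    \<Longrightarrow> eq_thy ar E (Fun f ss) (Fun f ts)"


section \<open>Ordered algebras\<close>

record ('f, 'a) ordered_algebra = "'a gorder" +
  opr :: "'f \<Rightarrow> 'a list \<Rightarrow> 'a"

locale complete_algebra = complete_lattice A
  for ar :: "'f \<Rightarrow> nat" and A :: "('f, 'a) ordered_algebra" (structure) +
  assumes opr_closed:
      "length as = ar f \<Longrightarrow> set as \<subseteq> carrier A \<Longrightarrow> opr A f as \<in> carrier A"
    and opr_mono:
      "length as = ar f \<Longrightarrow> set as \<subseteq> carrier A \<Longrightarrow> set bs \<subseteq> carrier A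
        \<Longrightarrow> list_all2 (le A) as bs \<Longrightarrow> opr A f as \<sqsubseteq> opr A f bs"

fun eval :: "('f, 'a) ordered_algebra \<Rightarrow> ('x \<Rightarrow> 'a) \<Rightarrow> ('f, 'x) trm \<Rightarrow> 'a" where
  "eval A \<sigma> (Var x) = \<sigma> x"
| "eval A \<sigma> (Fun f ts) = opr A f (map (eval A \<sigma>) ts)"

text \<open>Arbitrary joins include the empty one, so operations preserve \<open>\<bottom>\<close> in each argument.\<close>

locale continuous_model = complete_algebra ar A
  for ar :: "'f \<Rightarrow> nat" and E :: "('f, 'v) eqns" and A :: "('f, 'a) ordered_algebra" (structure) +
  assumes model:
      "(l, r) \<in> E \<Longrightarrow> (\<And>v. \<rho> v \<in> carrier A) \<Longrightarrow> eval A \<rho> l = eval A \<rho> r"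
    and opr_Sup:
      "length as = ar f \<Longrightarrow> set as \<subseteq> carrier A \<Longrightarrow> i < ar f \<Longrightarrow> S \<subseteq> carrier A
        \<Longrightarrow> opr A f (as[i := \<Squnion>S]) = \<Squnion>((\<lambda>s. opr A f (as[i := s])) ` S)"


section \<open>Expressions\<close>

datatype ('f, 'x) expr =
    EVar 'x
  | EFun 'f "('f, 'x) expr list"
  | EZero
  | EPlus "('f, 'x) expr" "('f, 'x) expr"
  | EMu 'x "('f, 'x) expr"

fun wf_expr :: "('f \<Rightarrow> nat) \<Rightarrow> ('f, 'x) expr \<Rightarrow> bool" where
  "wf_expr ar (EVar x) \<longleftrightarrow> True"
| "wf_expr ar (EFun f es) \<longleftrightarrow> length es = ar f \<and> (\<forall>e \<in> set es. wf_expr ar e)"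
| "wf_expr ar EZero \<longleftrightarrow> True"
| "wf_expr ar (EPlus e1 e2) \<longleftrightarrow> wf_expr ar e1 \<and> wf_expr ar e2"
| "wf_expr ar (EMu x e) \<longleftrightarrow> wf_expr ar e"

fun interp :: "('f, 'a) ordered_algebra \<Rightarrow> ('x \<Rightarrow> 'a) \<Rightarrow> ('f, 'x) expr \<Rightarrow> 'a" where
  "interp A \<sigma> (EVar x) = \<sigma> x"
| "interp A \<sigma> (EFun f es) = opr A f (map (interp A \<sigma>) es)"
| "interp A \<sigma> EZero = \<bottom>\<^bsub>A\<^esub>"
| "interp A \<sigma> (EPlus e1 e2) = interp A \<sigma> e1 \<squnion>\<^bsub>A\<^esub> interp A \<sigma> e2"
| "interp A \<sigma> (EMu x e) = LFP\<^bsub>A\<^esub> (\<lambda>a. interp A (\<sigma>(x := a)) e)"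


section \<open>Atoms and languages\<close>

definition eq_rel :: "('f \<Rightarrow> nat) \<Rightarrow> ('f, 'v) eqns \<Rightarrow> (('f, 'x) trm \<times> ('f, 'x) trm) set" where
  "eq_rel ar E = {(s, t). wf_trm ar s \<and> wf_trm ar t \<and> eq_thy ar E s t}"

type_synonym ('f, 'x) atom = "('f, 'x) trm set"

definition atoms :: "('f \<Rightarrow> nat) \<Rightarrow> ('f, 'v) eqns \<Rightarrow> ('f, 'x) atom set" where
  "atoms ar E = {t. wf_trm ar t} // eq_rel ar E"

definition atom_of :: "('f \<Rightarrow> nat) \<Rightarrow> ('f, 'v) eqns \<Rightarrow> ('f, 'x) trm \<Rightarrow> ('f, 'x) atom" where
  "atom_of ar E t = eq_rel ar E `` {t}"

text \<open>
  The operations of the quotient algebra, with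
  \<open>atom_opr ar E f [[t\<^sub>1], \<dots>, [t\<^sub>n]] = [f(t\<^sub>1, \<dots>, t\<^sub>n)]\<close>. The union
  ranges over all choices of representatives, which all contribute the same class.
\<close>

definition atom_opr ::
  "('f \<Rightarrow> nat) \<Rightarrow> ('f, 'v) eqns \<Rightarrow> 'f \<Rightarrow> ('f, 'x) atom list \<Rightarrow> ('f, 'x) atom" where
  "atom_opr ar E f as = (\<Union>ts \<in> {ts. list_all2 (\<in>) ts as}. atom_of ar E (Fun f ts))"

definition lang_alg ::
  "('f \<Rightarrow> nat) \<Rightarrow> ('f, 'v) eqns \<Rightarrow> ('f, ('f, 'x) atom set) ordered_algebra" where
  "lang_alg ar E =
    \<lparr> carrier = Pow (atoms ar E), eq = (=), le = (\<subseteq>),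
      opr = (\<lambda>f Ls. {atom_opr ar E f as | as. list_all2 (\<in>) as Ls}) \<rparr>"

definition lang_interp ::
  "('f \<Rightarrow> nat) \<Rightarrow> ('f, 'v) eqns \<Rightarrow> ('f, 'x) expr \<Rightarrow> ('f, 'x) atom set" where
  "lang_interp ar E e = interp (lang_alg ar E) (\<lambda>x. {atom_of ar E (Var x)}) e"

text \<open>
  Homomorphisms are taken to be \<open>undefined\<close> outside of the set of atoms (\<open>\<rightarrow>\<^sub>E\<close>), so
  that uniqueness is meaningful; see \<open>ex1_atom_hom\<close> below.
\<close>

definition atom_hom ::
  "('f \<Rightarrow> nat) \<Rightarrow> ('f, 'v) eqns \<Rightarrow> ('f, 'a) ordered_algebra \<Rightarrow> ('x \<Rightarrow> 'a)
    \<Rightarrow> (('f, 'x) atom \<Rightarrow> 'a) \<Rightarrow> bool" where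
  "atom_hom ar E M \<sigma> h \<longleftrightarrow>
    h \<in> atoms ar E \<rightarrow>\<^sub>E carrier M \<and>
    (\<forall>x. h (atom_of ar E (Var x)) = \<sigma> x) \<and>
    (\<forall>f as. length as = ar f \<longrightarrow> set as \<subseteq> atoms ar E \<longrightarrow>
      h (atom_opr ar E f as) = opr M f (map h as))"

definition atom_ext ::
  "('f \<Rightarrow> nat) \<Rightarrow> ('f, 'v) eqns \<Rightarrow> ('f, 'a) ordered_algebra \<Rightarrow> ('x \<Rightarrow> 'a)
    \<Rightarrow> ('f, 'x) atom \<Rightarrow> 'a" where
  "atom_ext ar E M \<sigma> = (THE h. atom_hom ar E M \<sigma> h)"

definition lang_ext ::
  "('f \<Rightarrow> nat) \<Rightarrow> ('f, 'v) eqns \<Rightarrow> ('f, 'a) ordered_algebra \<Rightarrow> ('x \<Rightarrow> 'a)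
    \<Rightarrow> ('f, 'x) atom set \<Rightarrow> 'a" where
  "lang_ext ar E M \<sigma> L = \<Squnion>\<^bsub>M\<^esub>(atom_ext ar E M \<sigma> ` L)"


section \<open>Well-definedness\<close>

lemma wf_subst: "wf_trm ar t \<Longrightarrow> (\<And>v. wf_trm ar (\<theta> v)) \<Longrightarrow> wf_trm ar (subst \<theta> t)"
  by (induction t) auto

lemma eq_thy_wf:
  assumes "wf_eqns ar E" and "eq_thy ar E s t"
  shows "wf_trm ar s \<and> wf_trm ar t"
  using assms(2)
proof induction
  case (ax l r \<theta>)
  then show ?case using assms(1) by (auto simp: wf_eqns_def intro!: wf_subst)
next
  case (cong ss f ts)
  then show ?case by (auto simp: list_all2_conv_all_nth in_set_conv_nth)
qed auto

lemma equiv_eq_rel: "equiv {t. wf_trm ar t} (eq_rel ar E)"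
proof (rule equivI)
  show "refl_on {t. wf_trm ar t} (eq_rel ar E)"
    by (auto simp: refl_on_def eq_rel_def intro: eq_thy.refl)
  show "sym (eq_rel ar E)"
    unfolding sym_def eq_rel_def by (blast intro: eq_thy.sym)
  show "trans (eq_rel ar E)"
    unfolding trans_def eq_rel_def by (blast intro: eq_thy.trans)
  show "eq_rel ar E \<subseteq> {t. wf_trm ar t} \<times> {t. wf_trm ar t}"
    by (auto simp: eq_rel_def)
qed

lemma atoms_eq: "atoms ar E = atom_of ar E ` {t. wf_trm ar t}"
  by (auto simp: atoms_def atom_of_def quotient_def)

lemma mem_atom_of: "s \<in> atom_of ar E t \<longleftrightarrow> wf_trm ar s \<and> wf_trm ar t \<and> eq_thy ar E t s"
  by (auto simp: atom_of_def eq_rel_def)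

lemma atom_of_eq_iff:
  assumes "wf_trm ar s" "wf_trm ar t"
  shows "atom_of ar E s = atom_of ar E t \<longleftrightarrow> eq_thy ar E s t"
  using eq_equiv_class_iff[OF equiv_eq_rel[of ar E], of s t] assms
  by (auto simp: atom_of_def eq_rel_def)

lemma atom_opr_atom_of:
  assumes "length ts = ar f" "\<forall>t \<in> set ts. wf_trm ar t"
  shows "atom_opr ar E f (map (atom_of ar E) ts) = atom_of ar E (Fun f ts)"
proof -
  have "atom_of ar E (Fun f ss) = atom_of ar E (Fun f ts)"
    if "list_all2 (\<in>) ss (map (atom_of ar E) ts)" for ss
  proof -
    have *: "length ss = length ts" "\<forall>i < length ts. wf_trm ar (ss ! i) \<and> eq_thy ar E (ts ! i) (ss ! i)"
      using that by (auto simp: list_all2_conv_all_nth mem_atom_of)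
    then have "eq_thy ar E (Fun f ts) (Fun f ss)"
      using assms by (intro eq_thy.cong) (auto simp: list_all2_conv_all_nth)
    moreover have "wf_trm ar (Fun f ss)" "wf_trm ar (Fun f ts)"
      using * assms by (auto simp: in_set_conv_nth)
    ultimately show ?thesis by (metis atom_of_eq_iff)
  qed
  moreover have "list_all2 (\<in>) ts (map (atom_of ar E) ts)"
    using assms by (auto simp: list_all2_conv_all_nth mem_atom_of intro: eq_thy.refl)
  ultimately show ?thesis unfolding atom_opr_def by blast
qed

lemma atoms_listE:
  assumes "set as \<subseteq> atoms ar E"
  obtains ts where "as = map (atom_of ar E) ts" "\<forall>t \<in> set ts. wf_trm ar t"
proof -
  have "as \<in> lists (atom_of ar E ` {t. wf_trm ar t})" using assms by (auto simp: atoms_eq)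
  then obtain ts where "ts \<in> lists {t. wf_trm ar t}" "as = map (atom_of ar E) ts"
    unfolding lists_image by auto
  then show ?thesis using that by auto
qed

lemma atom_opr_closed:
  assumes "set as \<subseteq> atoms ar E" "length as = ar f"
  shows "atom_opr ar E f as \<in> atoms ar E"
  using assms by (elim atoms_listE) (auto simp: atom_opr_atom_of atoms_eq)

lemma eval_subst: "eval A \<sigma> (subst \<theta> t) = eval A (\<lambda>v. eval A \<sigma> (\<theta> v)) t"
  by (induction t) (auto simp: comp_def cong: map_cong)

lemma (in complete_algebra) eval_closed:
  "(\<And>x. \<sigma> x \<in> carrier A) \<Longrightarrow> wf_trm ar t \<Longrightarrow> eval A \<sigma> t \<in> carrier A"
  by (induction t) (auto intro!: opr_closed)

lemma (in continuous_model) eval_eq_thy: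
  assumes \<sigma>: "\<And>x. \<sigma> x \<in> carrier A" and "eq_thy ar E s t"
  shows "eval A \<sigma> s = eval A \<sigma> t"
  using assms(2)
proof induction
  case (ax l r \<theta>)
  then show ?case by (auto simp: eval_subst intro!: model eval_closed \<sigma>)
next
  case (cong ss f ts)
  then have "map (eval A \<sigma>) ss = map (eval A \<sigma>) ts"
    by (auto simp: list_all2_conv_all_nth intro!: nth_equalityI)
  then show ?case by simp
qed auto

lemma atom_hom_atom_of:
  assumes "atom_hom ar E M \<sigma> h" and "wf_trm ar t"
  shows "h (atom_of ar E t) = eval M \<sigma> t"
  using assms(2)
proof (induction t)
  case (Var x)
  then show ?case using assms(1) by (simp add: atom_hom_def)
next
  case (Fun f ts)
  have "h (atom_of ar E (Fun f ts)) = h (atom_opr ar E f (map (atom_of ar E) ts))"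
    using Fun.prems by (simp add: atom_opr_atom_of)
  also have "\<dots> = opr M f (map h (map (atom_of ar E) ts))"
  proof -
    have "set (map (atom_of ar E) ts) \<subseteq> atoms ar E"
      using Fun.prems by (auto simp: atoms_eq)
    then show ?thesis using Fun.prems assms(1) unfolding atom_hom_def by simp
  qed
  also have "map h (map (atom_of ar E) ts) = map (eval M \<sigma>) ts"
    using Fun by auto
  finally show ?case by simp
qed

lemma (in continuous_model) ex1_atom_hom:
  fixes \<sigma> :: "'x \<Rightarrow> 'a"
  assumes \<sigma>: "\<And>x. \<sigma> x \<in> carrier A"
  shows "\<exists>!h. atom_hom ar E A \<sigma> h"
proof (rule ex_ex1I)
  define h :: "('f, 'x) atom \<Rightarrow> 'a" where "h = restrict (\<lambda>a. eval A \<sigma> (SOME t. t \<in> a)) (atoms ar E)"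
  have h: "h (atom_of ar E t) = eval A \<sigma> t" if "wf_trm ar t" for t
  proof -
    have "(SOME s. s \<in> atom_of ar E t) \<in> atom_of ar E t"
      using that by (intro someI[of "\<lambda>s. s \<in> atom_of ar E t" t]) (simp add: mem_atom_of eq_thy.refl)
    then have "eq_thy ar E t (SOME s. s \<in> atom_of ar E t)"
      using mem_atom_of by blast
    then have "eval A \<sigma> (SOME s. s \<in> atom_of ar E t) = eval A \<sigma> t"
      using eval_eq_thy \<sigma> by metis
    moreover have "atom_of ar E t \<in> atoms ar E" using that by (auto simp: atoms_eq)
    ultimately show ?thesis by (simp add: h_def)
  qed
  have "atom_hom ar E A \<sigma> h"
    unfolding atom_hom_def
  proof (intro conjI allI impI)
    show "h \<in> atoms ar E \<rightarrow>\<^sub>E carrier A"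
    proof (rule PiE_I)
      fix a :: "('f, 'x) atom" assume "a \<in> atoms ar E"
      then show "h a \<in> carrier A" by (auto simp: atoms_eq h intro!: eval_closed \<sigma>)
    qed (simp add: h_def)
  next
    fix f and as :: "('f, 'x) atom list" assume "length as = ar f" "set as \<subseteq> atoms ar E"
    then show "h (atom_opr ar E f as) = opr A f (map h as)"
      by (elim atoms_listE) (auto simp: atom_opr_atom_of h intro!: arg_cong[of _ _ "opr A f"])
  qed (simp add: h)
  then show "\<exists>h. atom_hom ar E A \<sigma> h"
    by blast
next
  fix h h' assume hs: "atom_hom ar E A \<sigma> h" "atom_hom ar E A \<sigma> h'"
  show "h = h'"
  proof (rule PiE_ext)
    show "h \<in> atoms ar E \<rightarrow>\<^sub>E carrier A" "h' \<in> atoms ar E \<rightarrow>\<^sub>E carrier A"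
      using hs by (simp_all add: atom_hom_def)
    fix a :: "('f, 'x) atom" assume "a \<in> atoms ar E"
    then show "h a = h' a"
      using hs[THEN atom_hom_atom_of] by (auto simp: atoms_eq)
  qed
qed

lemma (in continuous_model) atom_ext_atom_of:
  assumes "\<And>x. \<sigma> x \<in> carrier A" and "wf_trm ar t"
  shows "atom_ext ar E A \<sigma> (atom_of ar E t) = eval A \<sigma> t"
  using atom_hom_atom_of[OF theI'[OF ex1_atom_hom[OF assms(1)]] assms(2)]
  by (simp add: atom_ext_def)

lemma subst_cong: "(\<And>v. v \<in> set (var_list t) \<Longrightarrow> \<theta> v = \<theta>' v) \<Longrightarrow> subst \<theta> t = subst \<theta>' t"
  by (induction t) auto

lemma distinct_concat_disj:
  "distinct (concat xss) \<Longrightarrow> i < length xss \<Longrightarrow> j < length xss \<Longrightarrow> i \<noteq> j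
    \<Longrightarrow> set (xss ! i) \<inter> set (xss ! j) = {}"
proof (induction xss arbitrary: i j)
  case (Cons xs xss)
  then show ?case by (cases i; cases j) (fastforce simp: in_set_conv_nth[of _ xss])+
qed simp

lemma opr_lang_alg: "opr (lang_alg ar E) f Ls = {atom_opr ar E f as | as. list_all2 (\<in>) as Ls}"
  by (simp add: lang_alg_def)

lemma complete_lattice_lang_alg:
  fixes E :: "('f, 'v) eqns"
  shows "complete_lattice (lang_alg ar E :: ('f, ('f, 'x) atom set) ordered_algebra)"
proof unfold_locales
  fix S :: "('f, 'x) atom set set" assume "S \<subseteq> carrier (lang_alg ar E)"
  then show "\<exists>s. is_lub (lang_alg ar E) s S"
    by (intro exI[of _ "\<Union>S"]) (auto simp: least_def Upper_def lang_alg_def, blast)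
next
  fix S :: "('f, 'x) atom set set" assume "S \<subseteq> carrier (lang_alg ar E)"
  then show "\<exists>s. is_glb (lang_alg ar E) s S"
    by (intro exI[of _ "\<Inter>S \<inter> atoms ar E"]) (auto simp: greatest_def Lower_def lang_alg_def, blast)
qed (auto simp: lang_alg_def)

lemma Sup_lang_alg:
  assumes "S \<subseteq> Pow (atoms ar E)"
  shows "\<Squnion>\<^bsub>lang_alg ar E\<^esub> S = \<Union>S"
proof -
  interpret complete_lattice "lang_alg ar E" by (rule complete_lattice_lang_alg)
  have S: "S \<subseteq> carrier (lang_alg ar E)" using assms by (simp add: lang_alg_def)
  have "\<Squnion>\<^bsub>lang_alg ar E\<^esub> S \<subseteq> \<Union>S"
    using sup_least[OF S, of "\<Union>S"] assms by (auto simp: Upper_def lang_alg_def)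
  moreover have "\<Union>S \<subseteq> \<Squnion>\<^bsub>lang_alg ar E\<^esub> S"
    using sup_upper[OF S] by (auto simp: lang_alg_def)
  ultimately show ?thesis by blast
qed

lemma eval_lang_alg:
  fixes t :: "('f, 'v) trm" and E :: "('f, 'w) eqns"
  assumes "\<And>v. \<rho> v \<subseteq> atoms ar E" "wf_trm ar t" "distinct (var_list t)"
  shows "eval (lang_alg ar E) \<rho> t =
    {atom_of ar E (subst \<theta> t) | \<theta>.
      (\<forall>v. wf_trm ar (\<theta> v)) \<and> (\<forall>v \<in> set (var_list t). atom_of ar E (\<theta> v) \<in> \<rho> v)}"
  using assms(2,3)
proof (induction t)
  case (Var x)
  have "\<exists>\<theta>. a = atom_of ar E (\<theta> x) \<and> (\<forall>v. wf_trm ar (\<theta> v)) \<and> atom_of ar E (\<theta> x) \<in> \<rho> x"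
    if "a \<in> \<rho> x" for a
  proof -
    from that assms(1) obtain t where "wf_trm ar t" "a = atom_of ar E t"
      by (force simp: atoms_eq)
    with that show ?thesis by (intro exI[of _ "\<lambda>_. t"]) auto
  qed
  then show ?case by auto
next
  case (Fun f ts)
  have d: "distinct (var_list t)" "wf_trm ar t" if "t \<in> set ts" for t
    using that Fun.prems by (auto simp: distinct_concat_iff)
  note IH = Fun.IH[OF _ d(2,1)]
  have len: "length ts = ar f" using Fun.prems by simp
  show ?case (is "?L = ?R")
  proof (intro Set.set_eqI iffI)
    fix a assume "a \<in> ?L"
    then obtain as where as: "a = atom_opr ar E f as"
      "length as = length ts" "\<And>i. i < length ts \<Longrightarrow> as ! i \<in> eval (lang_alg ar E) \<rho> (ts ! i)"
      by (auto simp: opr_lang_alg list_all2_conv_all_nth)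
    have "\<forall>i < length ts. \<exists>\<theta>. as ! i = atom_of ar E (subst \<theta> (ts ! i)) \<and> (\<forall>v. wf_trm ar (\<theta> v)) \<and>
        (\<forall>v \<in> set (var_list (ts ! i)). atom_of ar E (\<theta> v) \<in> \<rho> v)"
      using as(3) IH by (auto)
    then obtain \<Theta> where \<Theta>: "\<And>i. i < length ts \<Longrightarrow> as ! i = atom_of ar E (subst (\<Theta> i) (ts ! i)) \<and>
        (\<forall>v. wf_trm ar (\<Theta> i v)) \<and> (\<forall>v \<in> set (var_list (ts ! i)). atom_of ar E (\<Theta> i v) \<in> \<rho> v)"
      by metis
    define P where "P v i \<longleftrightarrow> i < length ts \<and> v \<in> set (var_list (ts ! i))" for v i
    define \<theta> where "\<theta> v = (if \<exists>i. P v i then \<Theta> (SOME i. P v i) v else Var undefined)" for v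
    have uniq: "i = j" if "P v i" "P v j" for v i j
    proof (rule ccontr)
      assume "i \<noteq> j"
      have "distinct (concat (map var_list ts))" using Fun.prems by simp
      then have "set (map var_list ts ! i) \<inter> set (map var_list ts ! j) = {}"
        using that \<open>i \<noteq> j\<close> distinct_concat_disj[of "map var_list ts" i j] by (simp add: P_def)
      with that show False by (auto simp: P_def)
    qed
    have \<theta>: "\<theta> v = \<Theta> i v" if "P v i" for v i
      using that uniq someI[of "P v" i] by (metis \<theta>_def)
    have "wf_trm ar (\<theta> v)" for v
    proof (cases "\<exists>i. P v i")
      case True
      then obtain i where "P v i" by blast
      then show ?thesis using \<theta> \<Theta> by (simp add: P_def)
    next
      case False
      then show ?thesis by (simp add: \<theta>_def)
    qed
    moreover have "\<forall>v \<in> set (var_list (Fun f ts)). atom_of ar E (\<theta> v) \<in> \<rho> v"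
      using \<theta> \<Theta> by (auto simp: P_def in_set_conv_nth[of _ ts]) 
    moreover have "a = atom_of ar E (subst \<theta> (Fun f ts))"
    proof -
      have "subst \<theta> (ts ! i) = subst (\<Theta> i) (ts ! i)" if "i < length ts" for i
        using \<theta> that subst_cong by (intro subst_cong) (auto simp: P_def)
      then have "as = map (atom_of ar E) (map (subst \<theta>) ts)"
        using as(2) \<Theta> by (auto intro!: nth_equalityI)
      then show ?thesis using as(1) len d(2) \<open>\<And>v. wf_trm ar (\<theta> v)\<close>
        by (simp only: subst.simps, subst atom_opr_atom_of) (auto intro!: wf_subst)
    qed
    ultimately show "a \<in> ?R" by blast
  next
    fix a assume "a \<in> ?R"
    then obtain \<theta> where \<theta>: "a = atom_of ar E (subst \<theta> (Fun f ts))" "\<And>v. wf_trm ar (\<theta> v)"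
      "\<And>v. v \<in> set (var_list (Fun f ts)) \<Longrightarrow> atom_of ar E (\<theta> v) \<in> \<rho> v" by blast
    have "a = atom_opr ar E f (map (atom_of ar E) (map (subst \<theta>) ts))"
      using \<theta>(1,2) len d(2) by (subst atom_opr_atom_of) (auto intro!: wf_subst)
    moreover have "list_all2 (\<in>) (map (atom_of ar E) (map (subst \<theta>) ts)) (map (eval (lang_alg ar E) \<rho>) ts)"
    proof -
      have "atom_of ar E (subst \<theta> t) \<in> eval (lang_alg ar E) \<rho> t" if "t \<in> set ts" for t
        unfolding IH[OF that that that] using \<theta>(2,3) that by auto
      then show ?thesis by (simp add: list_all2_conv_all_nth)
    qed
    ultimately show "a \<in> ?L" by (auto simp: opr_lang_alg)
  qed
qed

lemma list_all2_mem_update: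
  assumes "i < length Ls"
  shows "list_all2 (\<in>) as (Ls[i := \<Union>S]) \<longleftrightarrow> (\<exists>L \<in> S. list_all2 (\<in>) as (Ls[i := L]))"
proof -
  have *: "list_all2 (\<in>) as (Ls[i := L]) \<longleftrightarrow> length as = length Ls \<and> as ! i \<in> L \<and>
      (\<forall>j < length Ls. j \<noteq> i \<longrightarrow> as ! j \<in> Ls ! j)" for L
    unfolding list_all2_conv_all_nth length_list_update
    using assms by (metis nth_list_update_eq nth_list_update_neq)
  show ?thesis unfolding * by blast
qed

lemma continuous_model_lang_alg:
  fixes E :: "('f, 'v) eqns"
  assumes "wf_eqns ar E" "linear_eqns E" "regular_eqns E"
  shows "continuous_model ar E (lang_alg ar E :: ('f, ('f, 'x) atom set) ordered_algebra)"
proof -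
  interpret complete_lattice "lang_alg ar E :: ('f, ('f, 'x) atom set) ordered_algebra"
    by (rule complete_lattice_lang_alg)
  have opr_cl: "opr (lang_alg ar E) f Ls \<subseteq> atoms ar E"
    if "length Ls = ar f" "set Ls \<subseteq> Pow (atoms ar E)" for f and Ls :: "('f, 'x) atom set list"
  proof -
    have "set as \<subseteq> atoms ar E" if "list_all2 (\<in>) as Ls" for as
    proof
      fix a assume "a \<in> set as"
      then obtain j where "j < length as" "a = as ! j" by (metis in_set_conv_nth)
      then have "a \<in> Ls ! j" "Ls ! j \<in> set Ls"
        using that by (auto simp: list_all2_conv_all_nth)
      then show "a \<in> atoms ar E" using \<open>set Ls \<subseteq> _\<close> by blast
    qed
    then show ?thesis using that
      by (auto simp: opr_lang_alg dest: list_all2_lengthD intro!: atom_opr_closed)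
  qed
  show ?thesis
  proof unfold_locales
    fix f and Ls :: "('f, 'x) atom set list"
    assume "length Ls = ar f" "set Ls \<subseteq> carrier (lang_alg ar E)"
    then show "opr (lang_alg ar E) f Ls \<in> carrier (lang_alg ar E)"
      using opr_cl by (simp add: lang_alg_def)
  next
    fix f and Ls Ks :: "('f, 'x) atom set list"
    assume "list_all2 (le (lang_alg ar E)) Ls Ks"
    then have "list_all2 (\<subseteq>) Ls Ks" by (simp add: lang_alg_def)
    then have "list_all2 (\<in>) as Ks" if "list_all2 (\<in>) as Ls" for as
      using that unfolding list_all2_conv_all_nth by (metis subsetD)
    then show "opr (lang_alg ar E) f Ls \<sqsubseteq>\<^bsub>lang_alg ar E\<^esub> opr (lang_alg ar E) f Ks"
      by (auto simp: lang_alg_def)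
  next
    fix l r and \<rho> :: "'v \<Rightarrow> ('f, 'x) atom set"
    assume lr: "(l, r) \<in> E" and "\<And>v. \<rho> v \<in> carrier (lang_alg ar E)"
    then have \<rho>: "\<And>v. \<rho> v \<subseteq> atoms ar E" by (simp add: lang_alg_def)
    have l: "wf_trm ar l" "distinct (var_list l)" and r: "wf_trm ar r" "distinct (var_list r)"
      and vars: "set (var_list l) = set (var_list r)"
      using lr assms by (auto simp: wf_eqns_def linear_eqns_def regular_eqns_def)
    have "atom_of ar E (subst \<theta> l) = atom_of ar E (subst \<theta> r)"
      if "\<forall>v. wf_trm ar (\<theta> v)" for \<theta> :: "'v \<Rightarrow> ('f, 'x) trm"
    proof -
      have "wf_trm ar (subst \<theta> l)" "wf_trm ar (subst \<theta> r)"
        using that l r by (auto intro!: wf_subst)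
      moreover have "eq_thy ar E (subst \<theta> l) (subst \<theta> r)"
        using lr that by (simp add: eq_thy.ax)
      ultimately show ?thesis by (simp add: atom_of_eq_iff)
    qed
    then show "eval (lang_alg ar E) \<rho> l = eval (lang_alg ar E) \<rho> r"
      unfolding eval_lang_alg[where \<rho> = \<rho>, OF \<rho> l] eval_lang_alg[where \<rho> = \<rho>, OF \<rho> r] vars
      by (intro Collect_cong ex_cong1) metis
  next
    fix Ls :: "('f, 'x) atom set list" and f i and S :: "('f, 'x) atom set set"
    assume *: "length Ls = ar f" "set Ls \<subseteq> carrier (lang_alg ar E)" "i < ar f"
      "S \<subseteq> carrier (lang_alg ar E)"
    then have S: "S \<subseteq> Pow (atoms ar E)" by (simp add: lang_alg_def)
    have "(\<lambda>L. opr (lang_alg ar E) f (Ls[i := L])) ` S \<subseteq> Pow (atoms ar E)"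
    proof (intro image_subsetI PowI opr_cl)
      fix L assume "L \<in> S"
      then show "set (Ls[i := L]) \<subseteq> Pow (atoms ar E)"
        using S *(2) set_update_subset_insert[of Ls i L] by (auto simp: lang_alg_def)
    qed (use * in simp)
    then show "opr (lang_alg ar E) f (Ls[i := \<Squnion>\<^bsub>lang_alg ar E\<^esub> S]) =
      \<Squnion>\<^bsub>lang_alg ar E\<^esub> ((\<lambda>L. opr (lang_alg ar E) f (Ls[i := L])) ` S)"
      unfolding Sup_lang_alg[OF S] using *
      by (subst Sup_lang_alg) (auto simp: opr_lang_alg list_all2_mem_update)
  qed
qed

end

theory Submission
  imports Defs
begin

text \<open>
  The extension \<open>\<bar>\<sigma>\<close> from languages to \<open>M\<close> preserves joins by construction, and preserves the
  operations because those of \<open>M\<close> distribute over joins in all arguments simultaneously. A map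
  with these two properties commutes with interpretation: for a fixpoint \<open>\<mu>x.e\<close>, preservation of
  joins supplies a right adjoint, along which prefixpoints are transported back from \<open>M\<close> to
  languages.
\<close>

section \<open>Joins, and monotonicity of interpretation\<close>

lemma (in complete_lattice) bottom_eq_sup_empty: "\<bottom> = \<Squnion>{}"
  using weak.weak_sup_empty eq_is_equal by simp

lemma (in complete_lattice) sup_UN:
  assumes "\<And>i. i \<in> I \<Longrightarrow> S i \<subseteq> carrier L"
  shows "\<Squnion>((\<lambda>i. \<Squnion>(S i)) ` I) = \<Squnion>(\<Union>i\<in>I. S i)"
proof (rule le_antisym)
  have S: "(\<Union>i\<in>I. S i) \<subseteq> carrier L" "(\<lambda>i. \<Squnion>(S i)) ` I \<subseteq> carrier L"
    using assms by auto
  then show "\<Squnion>((\<lambda>i. \<Squnion>(S i)) ` I) \<in> carrier L" "\<Squnion>(\<Union>i\<in>I. S i) \<in> carrier L"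
    by simp_all
  show "\<Squnion>((\<lambda>i. \<Squnion>(S i)) ` I) \<sqsubseteq> \<Squnion>(\<Union>i\<in>I. S i)"
  proof (rule weak.sup_least)
    fix x assume "x \<in> (\<lambda>i. \<Squnion>(S i)) ` I"
    then obtain i where i: "i \<in> I" "x = \<Squnion>(S i)" by blast
    have "\<Squnion>(S i) \<sqsubseteq> \<Squnion>(\<Union>i\<in>I. S i)"
    proof (rule weak.sup_least)
      fix y assume "y \<in> S i"
      then show "y \<sqsubseteq> \<Squnion>(\<Union>i\<in>I. S i)"
        using i S by (intro weak.sup_upper) auto
    qed (use i assms S in auto)
    then show "x \<sqsubseteq> \<Squnion>(\<Union>i\<in>I. S i)" using i by simp
  qed (use S in auto)
  show "\<Squnion>(\<Union>i\<in>I. S i) \<sqsubseteq> \<Squnion>((\<lambda>i. \<Squnion>(S i)) ` I)"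
  proof (rule weak.sup_least)
    fix x assume "x \<in> (\<Union>i\<in>I. S i)"
    then obtain i where i: "i \<in> I" "x \<in> S i" by blast
    then have "x \<sqsubseteq> \<Squnion>(S i)" "\<Squnion>(S i) \<sqsubseteq> \<Squnion>((\<lambda>i. \<Squnion>(S i)) ` I)"
      using assms S by (auto intro!: weak.sup_upper)
    then show "x \<sqsubseteq> \<Squnion>((\<lambda>i. \<Squnion>(S i)) ` I)"
      using i assms S by (meson le_trans subsetD weak.sup_closed)
  qed (use S in auto)
qed

lemma (in complete_algebra) interp_closed:
  assumes "wf_expr ar e" and "\<And>x. \<sigma> x \<in> carrier A"
  shows "interp A \<sigma> e \<in> carrier A"
  using assms by (induction e arbitrary: \<sigma>) (auto intro!: opr_closed)

lemma (in complete_algebra) interp_mono: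
  assumes "wf_expr ar e" and "\<And>x. \<sigma> x \<in> carrier A" and "\<And>x. \<tau> x \<in> carrier A"
    and "\<And>x. \<sigma> x \<sqsubseteq> \<tau> x"
  shows "interp A \<sigma> e \<sqsubseteq> interp A \<tau> e"
  using assms
proof (induction e arbitrary: \<sigma> \<tau>)
  case (EFun f es)
  then show ?case
    by (auto simp: list_all2_conv_all_nth intro!: opr_mono interp_closed)
next
  case (EPlus e1 e2)
  then have c: "interp A \<rho> e \<in> carrier A" if "\<rho> \<in> {\<sigma>, \<tau>}" "e \<in> {e1, e2}" for \<rho> e
    using that by (auto intro!: interp_closed)
  from EPlus have "interp A \<sigma> e1 \<sqsubseteq> interp A \<tau> e1" "interp A \<sigma> e2 \<sqsubseteq> interp A \<tau> e2" by auto
  moreover have "interp A \<tau> e1 \<sqsubseteq> interp A \<tau> e1 \<squnion> interp A \<tau> e2"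
    "interp A \<tau> e2 \<sqsubseteq> interp A \<tau> e1 \<squnion> interp A \<tau> e2"
    using c by (simp_all add: join_left join_right)
  ultimately show ?case
    using c by (auto intro!: join_le intro: le_trans)
next
  case (EMu x e)
  let ?F = "\<lambda>\<rho> a. interp A (\<rho>(x := a)) e"
  have "LFP (?F \<sigma>) \<sqsubseteq> LFP (?F \<tau>)"
  proof (rule weak.LFP_greatest)
    fix u assume u: "u \<in> carrier A" "?F \<tau> u \<sqsubseteq> u"
    \<comment> \<open>Least fixpoints are meets of prefixpoints, so it is enough that every
      prefixpoint \<open>u\<close> of \<open>?F \<tau>\<close> is also one of
      \<open>?F \<sigma>\<close>.\<close>
    have "?F \<sigma> u \<sqsubseteq> ?F \<tau> u" using EMu u by simp
    then have "?F \<sigma> u \<sqsubseteq> u"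
      using u EMu.prems by (elim le_trans) (auto intro!: interp_closed)
    then show "LFP (?F \<sigma>) \<sqsubseteq> u" using u by (auto intro: weak.LFP_lowerbound)
  qed simp
  then show ?case by simp
qed auto

text \<open>Needed to unfold fixpoints: \<open>LFP\<close> is the meet of all prefixpoints, and
  Knaster-Tarski makes it a fixpoint once the function is monotone.\<close>

lemma (in complete_algebra) isotone_interp:
  assumes "wf_expr ar e" and "\<And>x. \<sigma> x \<in> carrier A"
  shows "Mono (\<lambda>a. interp A (\<sigma>(x := a)) e)"
  using assms weak_partial_order_axioms by (auto intro!: isotoneI interp_mono)

section \<open>Maps preserving joins and operations\<close>

text \<open>Joins range over all subsets of the carrier, the empty one included, so \<open>h\<close>
  sends \<bottom> to \<bottom>, is monotone and has a right adjoint.\<close>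

locale sup_hom = A: complete_algebra ar A + M: complete_algebra ar M
  for ar :: "'f \<Rightarrow> nat" and A :: "('f, 'a) ordered_algebra" and M :: "('f, 'm) ordered_algebra" +
  fixes h :: "'a \<Rightarrow> 'm"
  assumes hom_closed: "a \<in> carrier A \<Longrightarrow> h a \<in> carrier M"
    and hom_Sup: "S \<subseteq> carrier A \<Longrightarrow> h (\<Squnion>\<^bsub>A\<^esub>S) = \<Squnion>\<^bsub>M\<^esub>(h ` S)"
    and hom_opr: "length as = ar f \<Longrightarrow> set as \<subseteq> carrier A
        \<Longrightarrow> h (opr A f as) = opr M f (map h as)"
begin

lemma hom_join:
  "a \<in> carrier A \<Longrightarrow> b \<in> carrier A \<Longrightarrow> h (a \<squnion>\<^bsub>A\<^esub> b) = h a \<squnion>\<^bsub>M\<^esub> h b"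
  by (simp add: join_def hom_Sup)

lemma hom_mono:
  assumes "a \<in> carrier A" "b \<in> carrier A" "a \<sqsubseteq>\<^bsub>A\<^esub> b"
  shows "h a \<sqsubseteq>\<^bsub>M\<^esub> h b"
proof -
  have "a \<squnion>\<^bsub>A\<^esub> b = b"
    using assms by (intro A.le_antisym A.join_le) (auto simp: A.join_right)
  then have "h b = h a \<squnion>\<^bsub>M\<^esub> h b" using assms hom_join by metis
  then show ?thesis using assms hom_closed M.join_left by metis
qed

text \<open>The image of a fixpoint of \<open>F\<close> is a fixpoint of \<open>G\<close>, which
  gives one inequality. For the other, \<open>LFP\<close> of \<open>G\<close> need not be known to
  lie in the image of \<open>h\<close>; it is pulled back along the right adjoint of
  \<open>h\<close> to a prefixpoint of \<open>F\<close>.\<close>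

lemma hom_LFP:
  assumes F: "Mono\<^bsub>A\<^esub> F" "F \<in> carrier A \<rightarrow> carrier A"
    and G: "Mono\<^bsub>M\<^esub> G" "G \<in> carrier M \<rightarrow> carrier M"
    and FG: "\<And>a. a \<in> carrier A \<Longrightarrow> h (F a) = G (h a)"
  shows "h (LFP\<^bsub>A\<^esub> F) = LFP\<^bsub>M\<^esub> G"
proof (rule M.le_antisym)
  let ?m = "LFP\<^bsub>M\<^esub> G"
  show "h (LFP\<^bsub>A\<^esub> F) \<in> carrier M" "?m \<in> carrier M" by (auto intro: hom_closed)
  have "G (h (LFP\<^bsub>A\<^esub> F)) = h (LFP\<^bsub>A\<^esub> F)"
    using FG A.LFP_unfold[OF F] A.weak.LFP_closed by metis
  then show "?m \<sqsubseteq>\<^bsub>M\<^esub> h (LFP\<^bsub>A\<^esub> F)"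
    by (intro M.weak.LFP_lowerbound) (auto intro: hom_closed)
  \<comment> \<open>\<open>b\<close> is the value of the right adjoint at \<open>?m\<close>: the
    largest element that \<open>h\<close> maps below \<open>?m\<close>. That \<open>h b\<close>
    itself stays below \<open>?m\<close> uses preservation of arbitrary joins.\<close>
  define S where "S = {a \<in> carrier A. h a \<sqsubseteq>\<^bsub>M\<^esub> ?m}"
  define b where "b = \<Squnion>\<^bsub>A\<^esub>S"
  have S: "S \<subseteq> carrier A" by (auto simp: S_def)
  then have b: "b \<in> carrier A" by (simp add: b_def)
  have hb: "h b \<sqsubseteq>\<^bsub>M\<^esub> ?m"
    unfolding b_def hom_Sup[OF S] by (rule M.weak.sup_least) (auto simp: S_def intro: hom_closed)
  \<comment> \<open>Since \<open>h (F b) = G (h b)\<close> and \<open>G ?m = ?m\<close>, the element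
    \<open>F b\<close> is again in \<open>S\<close>, hence below \<open>b\<close>; so
    \<open>b\<close> is a prefixpoint of \<open>F\<close>.\<close>
  have "h (F b) \<sqsubseteq>\<^bsub>M\<^esub> G ?m"
    using FG[OF b] use_iso1[OF G(1) _ _ hb] hom_closed[OF b] by simp
  then have "F b \<in> S"
    using M.LFP_unfold[OF G] F(2) b by (auto simp: S_def)
  then have "F b \<sqsubseteq>\<^bsub>A\<^esub> b" unfolding b_def using S by (intro A.weak.sup_upper)
  then have "h (LFP\<^bsub>A\<^esub> F) \<sqsubseteq>\<^bsub>M\<^esub> h b"
    using b by (intro hom_mono A.weak.LFP_lowerbound) auto
  then show "h (LFP\<^bsub>A\<^esub> F) \<sqsubseteq>\<^bsub>M\<^esub> ?m"
    using hb b by (auto intro: M.le_trans hom_closed)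
qed

text \<open>The induction keeps the valuation arbitrary, because the body of a fixpoint is
  interpreted under updated valuations.\<close>

lemma hom_interp:
  assumes "wf_expr ar e" and "\<And>x. \<rho> x \<in> carrier A"
  shows "h (interp A \<rho> e) = interp M (\<lambda>x. h (\<rho> x)) e"
  using assms
proof (induction e arbitrary: \<rho>)
  case (EFun f es)
  then have eq: "map (h \<circ> interp A \<rho>) es = map (interp M (\<lambda>x. h (\<rho> x))) es" by auto
  moreover have "set (map (interp A \<rho>) es) \<subseteq> carrier A"
    using EFun.prems by (auto intro!: A.interp_closed)
  ultimately show ?case using EFun.prems by (simp add: hom_opr eq)
next
  case EZero
  then show ?case by (simp add: A.bottom_eq_sup_empty M.bottom_eq_sup_empty hom_Sup)
next
  case (EPlus e1 e2)
  then show ?case by (simp add: hom_join A.interp_closed)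
next
  case (EMu x e)
  let ?F = "\<lambda>a. interp A (\<rho>(x := a)) e"
  let ?G = "\<lambda>m. interp M ((\<lambda>y. h (\<rho> y))(x := m)) e"
  have "h (LFP\<^bsub>A\<^esub> ?F) = LFP\<^bsub>M\<^esub> ?G"
  proof (rule hom_LFP)
    show "Mono\<^bsub>A\<^esub> ?F" "Mono\<^bsub>M\<^esub> ?G"
      using EMu.prems by (auto intro!: A.isotone_interp M.isotone_interp hom_closed)
    show "?F \<in> carrier A \<rightarrow> carrier A" "?G \<in> carrier M \<rightarrow> carrier M"
      using EMu.prems by (auto intro!: A.interp_closed M.interp_closed hom_closed)
    fix a assume "a \<in> carrier A"
    then have "h (?F a) = interp M (\<lambda>y. h ((\<rho>(x := a)) y)) e"
      using EMu by (intro EMu.IH) auto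
    also have "(\<lambda>y. h ((\<rho>(x := a)) y)) = (\<lambda>y. h (\<rho> y))(x := h a)" by auto
    finally show "h (?F a) = ?G (h a)" .
  qed
  then show ?case by simp
qed simp

end

section \<open>Distributing operations over joins in all arguments\<close>

lemma list_all2_mem_subset:
  "list_all2 (\<in>) as Ss \<Longrightarrow> \<forall>S\<in>set Ss. S \<subseteq> C \<Longrightarrow> set as \<subseteq> C"
  by (induction rule: list_all2_induct) auto

text \<open>\<open>opr_Sup\<close> treats one argument at a time, so joins are pulled out from left
  to right: \<open>xs\<close> holds the arguments already reduced to single elements,
  \<open>Ss\<close> the sets still to be joined. The induction hypothesis is applied to
  \<open>xs @ [s]\<close>.\<close>

lemma (in continuous_model) opr_append_Sup:
  assumes "length xs + length Ss = ar f" "set xs \<subseteq> carrier A" "\<forall>S\<in>set Ss. S \<subseteq> carrier A"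
  shows "opr A f (xs @ map (\<lambda>S. \<Squnion>S) Ss) = \<Squnion>{opr A f (xs @ as) | as. list_all2 (\<in>) as Ss}"
  using assms
proof (induction Ss arbitrary: xs)
  case Nil
  then show ?case by (simp add: opr_closed)
next
  case (Cons S Ss)
  let ?R = "\<lambda>s. {opr A f ((xs @ [s]) @ as) | as. list_all2 (\<in>) as Ss}"
  let ?ys = "map (\<lambda>S. \<Squnion>S) Ss"
  have S: "S \<subseteq> carrier A" using Cons.prems by simp
  have c: "set as \<subseteq> carrier A" if "list_all2 (\<in>) as Ss" for as
    using list_all2_mem_subset[OF that] Cons.prems(3) by simp
  \<comment> \<open>\<bottom> is a placeholder from the carrier that brings the argument list into
    the update form of \<open>opr_Sup\<close>; the update at index \<open>length xs\<close>
    overwrites it.\<close>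
  have "opr A f (xs @ map (\<lambda>S. \<Squnion>S) (S # Ss)) = opr A f ((xs @ \<bottom> # ?ys)[length xs := \<Squnion>S])"
    by simp
  also have "\<dots> = \<Squnion>((\<lambda>s. opr A f ((xs @ \<bottom> # ?ys)[length xs := s])) ` S)"
    using Cons.prems by (intro opr_Sup) auto
  also have "\<dots> = \<Squnion>((\<lambda>s. \<Squnion>(?R s)) ` S)"
  proof (intro arg_cong[where f = "\<lambda>X. \<Squnion>X"] image_cong)
    fix s assume "s \<in> S"
    then have "opr A f ((xs @ [s]) @ ?ys) = \<Squnion>(?R s)"
      using Cons.prems S by (intro Cons.IH) auto
    then show "opr A f ((xs @ \<bottom> # ?ys)[length xs := s]) = \<Squnion>(?R s)" by simp
  qed simp
  \<comment> \<open>The join over \<open>s\<close> and the joins over choices from \<open>Ss\<close>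
    merge into one join over choices from \<open>S # Ss\<close>.\<close>
  also have "\<dots> = \<Squnion>(\<Union>s\<in>S. ?R s)"
  proof (intro sup_UN subsetI)
    fix s b assume "s \<in> S" "b \<in> ?R s"
    then obtain as where as: "b = opr A f (xs @ s # as)" "list_all2 (\<in>) as Ss" by auto
    then show "b \<in> carrier A"
      using \<open>s \<in> S\<close> S Cons.prems c[OF as(2)] list_all2_lengthD[OF as(2)]
      by (auto intro!: opr_closed)
  qed
  also have "(\<Union>s\<in>S. ?R s) = {opr A f (xs @ as) | as. list_all2 (\<in>) as (S # Ss)}"
    by (fastforce simp: list_all2_Cons2)
  finally show ?case .
qed

lemma (in continuous_model) opr_Sup_all:
  assumes "length Ss = ar f" "\<forall>S\<in>set Ss. S \<subseteq> carrier A"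
  shows "opr A f (map (\<lambda>S. \<Squnion>S) Ss) = \<Squnion>{opr A f as | as. list_all2 (\<in>) as Ss}"
  using opr_append_Sup[of "[]" Ss f] assms by simp

text \<open>A choice from the images lifts to a choice from the sets themselves by picking preimages
  position by position. This brings the image of a language operation into the form of
  \<open>opr_Sup_all\<close>.\<close>

lemma list_all2_mem_image:
  "list_all2 (\<in>) bs (map ((`) g) Ls) \<longleftrightarrow> (\<exists>as. bs = map g as \<and> list_all2 (\<in>) as Ls)"
proof (induction Ls arbitrary: bs)
  case (Cons L Ls)
  show ?case
  proof
    assume "list_all2 (\<in>) bs (map ((`) g) (L # Ls))"
    then obtain a as where "bs = map g (a # as)" "a \<in> L" "list_all2 (\<in>) as Ls"
      using Cons.IH by (auto simp: list_all2_Cons2)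
    then show "\<exists>as. bs = map g as \<and> list_all2 (\<in>) as (L # Ls)"
      by (intro exI[of _ "a # as"]) simp
  qed (use Cons.IH in \<open>auto simp: list_all2_Cons2\<close>)
qed simp

section \<open>The extension of a valuation to languages\<close>

text \<open>Joins of languages are unions, and images commute with unions; this gives preservation
  of joins. For an operation, the homomorphism on atoms acts elementwise, and
  \<open>opr_Sup_all\<close> turns the join over all choices of atoms into the operation applied to
  the joins.\<close>

lemma (in continuous_model) sup_hom_lang_ext:
  fixes \<sigma> :: "'x \<Rightarrow> 'a"
  assumes "wf_eqns ar E" "linear_eqns E" "regular_eqns E" and \<sigma>: "\<And>x. \<sigma> x \<in> carrier A"
  shows "sup_hom ar (lang_alg ar E) A (lang_ext ar E A \<sigma>)"
proof -
  let ?h = "atom_ext ar E A \<sigma>"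
  interpret Lang: continuous_model ar E "lang_alg ar E :: ('f, ('f, 'x) atom set) ordered_algebra"
    using assms(1-3) by (rule continuous_model_lang_alg)
  have hom: "atom_hom ar E A \<sigma> ?h"
    unfolding atom_ext_def using ex1_atom_hom[OF \<sigma>] by (rule theI')
  have cl: "?h ` L \<subseteq> carrier A" if "L \<subseteq> atoms ar E" for L
    using hom that by (auto simp: atom_hom_def)
  have car: "carrier (lang_alg ar E) = Pow (atoms ar E)" by (simp add: lang_alg_def)
  show ?thesis
  proof unfold_locales
    fix L :: "('f, 'x) atom set" assume "L \<in> carrier (lang_alg ar E)"
    then show "lang_ext ar E A \<sigma> L \<in> carrier A"
      unfolding lang_ext_def car by (intro weak.sup_closed cl) simp
  next
    fix S :: "('f, 'x) atom set set" assume "S \<subseteq> carrier (lang_alg ar E)"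
    then have S: "S \<subseteq> Pow (atoms ar E)" by (simp add: car)
    have "\<Squnion>(?h ` \<Union>S) = \<Squnion>(\<Union>L\<in>S. ?h ` L)" by (simp add: image_Union)
    also have "\<dots> = \<Squnion>((\<lambda>L. \<Squnion>(?h ` L)) ` S)"
      using S by (intro sup_UN[symmetric] cl) auto
    finally show "lang_ext ar E A \<sigma> (\<Squnion>\<^bsub>lang_alg ar E\<^esub>S) = \<Squnion>(lang_ext ar E A \<sigma> ` S)"
      unfolding Sup_lang_alg[OF S] lang_ext_def by simp
  next
    fix f and Ls :: "('f, 'x) atom set list"
    assume len: "length Ls = ar f" and "set Ls \<subseteq> carrier (lang_alg ar E)"
    then have Ls: "\<forall>L\<in>set Ls. L \<subseteq> atoms ar E" by (auto simp: car)
    have as: "length as = ar f \<and> set as \<subseteq> atoms ar E" if "list_all2 (\<in>) as Ls" for as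
      using that Ls len list_all2_mem_subset[OF that] by (simp add: list_all2_lengthD)
    have "?h ` opr (lang_alg ar E) f Ls = {?h (atom_opr ar E f as) | as. list_all2 (\<in>) as Ls}"
      by (auto simp: opr_lang_alg)
    also have "\<dots> = {opr A f (map ?h as) | as. list_all2 (\<in>) as Ls}"
      using as hom by (intro Collect_cong ex_cong1) (auto simp: atom_hom_def)
    also have "\<dots> = {opr A f bs | bs. list_all2 (\<in>) bs (map ((`) ?h) Ls)}"
      unfolding list_all2_mem_image by blast
    finally have "lang_ext ar E A \<sigma> (opr (lang_alg ar E) f Ls) =
        \<Squnion>{opr A f bs | bs. list_all2 (\<in>) bs (map ((`) ?h) Ls)}"
      by (simp add: lang_ext_def)
    also have "\<dots> = opr A f (map (\<lambda>S. \<Squnion>S) (map ((`) ?h) Ls))"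
      using len Ls cl by (intro opr_Sup_all[symmetric]) auto
    also have "map (\<lambda>S. \<Squnion>S) (map ((`) ?h) Ls) = map (lang_ext ar E A \<sigma>) Ls"
      by (simp add: lang_ext_def)
    finally show "lang_ext ar E A \<sigma> (opr (lang_alg ar E) f Ls) = opr A f (map (lang_ext ar E A \<sigma>) Ls)" .
  qed
qed

theorem theorem3p15:
  fixes ar :: "'f \<Rightarrow> nat" and E :: "('f, 'v) eqns"
    and M :: "('f, 'm) ordered_algebra" and \<sigma> :: "'x \<Rightarrow> 'm" and e :: "('f, 'x) expr"
  assumes "wf_eqns ar E" and "linear_eqns E" and "regular_eqns E"
    and "continuous_model ar E M"
    and "\<And>x. \<sigma> x \<in> carrier M"
    and "wf_expr ar e"
  shows "interp M \<sigma> e = lang_ext ar E M \<sigma> (lang_interp ar E e)"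
proof -
  interpret M: continuous_model ar E M by (rule assms(4))
  interpret sup_hom ar "lang_alg ar E" M "lang_ext ar E M \<sigma>"
    using assms(1-3,5) by (rule M.sup_hom_lang_ext)
  \<comment> \<open>The join of a singleton is its element, so the extension sends the standard
    valuation back to \<sigma>, and \<open>hom_interp\<close> at that valuation yields the
    interpretation under \<sigma>.\<close>
  have "lang_ext ar E M \<sigma> {atom_of ar E (Var x)} = \<sigma> x" for x
    using assms(5) by (simp add: lang_ext_def M.atom_ext_atom_of)
  moreover have "lang_ext ar E M \<sigma> (lang_interp ar E e) =
      interp M (\<lambda>x. lang_ext ar E M \<sigma> {atom_of ar E (Var x)}) e"
    unfolding lang_interp_def using assms(6)
    by (rule hom_interp) (simp add: lang_alg_def atoms_eq)
  ultimately show ?thesis by simp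
qed

end
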